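(* Let $(\pi,U,H)$ be a covariant representation of a $C^*$-dynamical system $(\mathcal A,\delta)$. Then there exists a unique $*$-homomorphism $\Psi_{(\pi,U)}$ from $\mathcal M(\mathcal A)$ onto the $*$-algebra $C_0^*(\pi(\mathcal A),U)$ generated by $\pi(\mathcal A)$ and $U$ such that $$\Psi_{(\pi,U)}(a)=\pi(a),\quad a\in\mathcal A,\qquad \Psi_{(\pi,U)}(u)=U.$$ Moreover, $\Psi_{(\pi,U)}$ is given by the formula $$\Psi_{(\pi,U)}(\{a_{m,n}\}_{m,n\in\mathbb N})=\sum_{m,n=0}^\infty U^{*m}\pi(a_{m,n})U^n,$$ and thus $C_0^*(\pi(\mathcal A),U)=\big\{\sum_{m,n=0}^\infty U^{*m}\pi(a_{m,n})U^n:\{a_{m,n}\}_{m,n\in\mathbb N}\in\mathcal M(\mathcal A)\big\}$.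
   Context: A $C^*$-dynamical system $(\mathcal A,\delta)$ is a unital $C^*$-algebra $\mathcal A$ with a $*$-endomorphism $\delta:\mathcal A\to\mathcal A$ (not assumed unital or injective). A covariant representation of $(\mathcal A,\delta)$ is a triple $(\pi,U,H)$ where $\pi:\mathcal A\to\mathcal B(H)$ is a non-degenerate faithful $*$-representation on a Hilbert space $H$ and $U\in\mathcal B(H)$ is a partial isometry with $U\pi(a)U^*=\pi(\delta(a))$ for all $a\in\mathcal A$ and $U^*U\in\pi(\mathcal A)'$ (the commutant). $\mathbb N=\{0,1,2,\dots\}$. $\mathcal M(\mathcal A)$ is the set of infinite matrices $\{a_{ij}\}_{i,j\in\mathbb N}$ with $a_{ij}\in\delta^i(1)\mathcal A\delta^j(1)$ and only finitely many non-zero entries. It is a $*$-algebra under entrywise addition and scalar multiplication, involution $(a^* )_{m,n}=a_{n,m}^*$, and multiplication $a\star b=a\cdot\sum_{j=0}^\infty\Lambda^j(b)+\sum_{j=1}^\infty\Lambda^j(a)\cdot b$, where $\cdot$ is the usual matrix product and $\Lambda(a)_{ij}=\delta(a_{i-1,j-1})$ for $i,j\ge1$, $\Lambda(a)_{ij}=0$ otherwise. An element $a\in\mathcal A$ is identified with the matrix whose $(0,0)$ entry is $a$ and whose other entries are $0$; $u\in\mathcal M(\mathcal A)$ is the matrix with $u_{01}=\delta(1)$ and all other entries $0$. *)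

theory Defs
  imports
    "HOL-Analysis.Analysis"
    "HOL-Library.Groups_Big_Fun"
begin

section \<open>Complex vector spaces, \<open>*\<close>-algebras and unital \<open>C*\<close>-algebras\<close>

class complex_vector = real_vector +
  fixes scaleC :: "complex \<Rightarrow> 'a \<Rightarrow> 'a"  (infixr \<open>*\<^sub>C\<close> 75)
  assumes scaleC_add_right: "c *\<^sub>C (x + y) = c *\<^sub>C x + c *\<^sub>C y"
    and scaleC_add_left: "(c + d) *\<^sub>C x = c *\<^sub>C x + d *\<^sub>C x"
    and scaleC_scaleC: "c *\<^sub>C d *\<^sub>C x = (c * d) *\<^sub>C x"
    and scaleC_of_real: "complex_of_real r *\<^sub>C x = r *\<^sub>R x"

global_interpretation complex_vector?: vector_space "scaleC :: complex \<Rightarrow> 'a \<Rightarrow> 'a :: complex_vector"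
  defines csubspace = complex_vector.subspace
    and cspan = complex_vector.span
proof unfold_locales
  fix x :: 'a
  show "1 *\<^sub>C x = x"
    using scaleC_of_real[of 1 x] by simp
qed (auto simp: scaleC_add_right scaleC_add_left scaleC_scaleC)

text \<open>Neither a unit nor continuity is part of this class.\<close>

class complex_star_algebra = complex_vector + ring +
  fixes star :: "'a \<Rightarrow> 'a"
  assumes mult_scaleC_left: "(c *\<^sub>C x) * y = c *\<^sub>C (x * y)"
    and mult_scaleC_right: "x * (c *\<^sub>C y) = c *\<^sub>C (x * y)"
    and star_add: "star (x + y) = star x + star y"
    and star_scaleC: "star (c *\<^sub>C x) = cnj c *\<^sub>C star x"
    and star_mult: "star (x * y) = star y * star x"
    and star_star: "star (star x) = x"

text \<open>
  The unit comes from \<^class>\<open>monoid_mult\<close> rather than from \<^class>\<open>ring_1\<close>, so that the zero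
  algebra is not excluded. That the norm is homogeneous for complex scalars follows from the
  \<open>C*\<close>-identity.
\<close>

class unital_cstar_algebra = complex_star_algebra + banach + real_normed_algebra + monoid_mult +
  assumes cstar_identity: "norm (star x * x) = (norm x)\<^sup>2"

definition star_hom :: "('a::complex_star_algebra \<Rightarrow> 'b::complex_star_algebra) \<Rightarrow> bool" where
  "star_hom f \<longleftrightarrow>
     (\<forall>x y. f (x + y) = f x + f y) \<and>
     (\<forall>c x. f (c *\<^sub>C x) = c *\<^sub>C f x) \<and>
     (\<forall>x y. f (x * y) = f x * f y) \<and>
     (\<forall>x. f (star x) = star (f x))"

definition star_subalgebra :: "'a::complex_star_algebra set \<Rightarrow> bool" where
  "star_subalgebra B \<longleftrightarrow>
     csubspace B \<and> (\<forall>x\<in>B. \<forall>y\<in>B. x * y \<in> B) \<and> (\<forall>x\<in>B. star x \<in> B)"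

definition generated_star_algebra :: "'a::complex_star_algebra set \<Rightarrow> 'a set" where
  "generated_star_algebra S = \<Inter> {B. star_subalgebra B \<and> S \<subseteq> B}"

definition commutant :: "'a::complex_star_algebra set \<Rightarrow> 'a set" where
  "commutant S = {t. \<forall>s\<in>S. t * s = s * t}"


section \<open>Hilbert spaces and their bounded operators\<close>

text \<open>The inner product is linear in its first argument.\<close>

class chilbert_space = complex_vector + banach +
  fixes cinner :: "'a \<Rightarrow> 'a \<Rightarrow> complex"
  assumes cinner_commute: "cinner x y = cnj (cinner y x)"
    and cinner_add_left: "cinner (x + y) z = cinner x z + cinner y z"
    and cinner_scaleC_left: "cinner (c *\<^sub>C x) y = c * cinner x y"
    and cinner_self: "cinner x x = complex_of_real ((norm x)\<^sup>2)"

definition bounded_clinear :: "('h::chilbert_space \<Rightarrow> 'h) \<Rightarrow> bool" where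
  "bounded_clinear T \<longleftrightarrow> bounded_linear T \<and> (\<forall>c x. T (c *\<^sub>C x) = c *\<^sub>C T x)"

lemma cinner_add_right: "cinner x (y + z) = cinner x y + cinner (x::'h::chilbert_space) z"
  using cinner_commute[of x "y + z"] cinner_commute[of x y] cinner_commute[of x z]
  by (simp add: cinner_add_left)

lemma cinner_scaleC_right: "cinner x (c *\<^sub>C y) = cnj c * cinner (x::'h::chilbert_space) y"
  using cinner_commute[of x "c *\<^sub>C y"] cinner_commute[of x y]
  by (simp add: cinner_scaleC_left)

lemma cinner_scaleR_left: "cinner (r *\<^sub>R x) y = of_real r * cinner (x::'h::chilbert_space) y"
  by (metis scaleC_of_real cinner_scaleC_left)

lemma cinner_scaleR_right: "cinner x (r *\<^sub>R y) = of_real r * cinner (x::'h::chilbert_space) y"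
  by (metis scaleC_of_real cinner_scaleC_right complex_cnj_complex_of_real)

lemma cinner_minus_left: "cinner (- x) y = - cinner (x::'h::chilbert_space) y"
  using cinner_scaleR_left[of "-1" x y] by simp

lemma cinner_minus_right: "cinner x (- y) = - cinner (x::'h::chilbert_space) y"
  using cinner_scaleR_right[of x "-1" y] by simp

lemma cinner_diff_left: "cinner (x - y) z = cinner x z - cinner (y::'h::chilbert_space) z"
  using cinner_add_left[of x "- y" z] by (simp add: cinner_minus_left)

lemma cinner_diff_right: "cinner x (y - z) = cinner x y - cinner (x::'h::chilbert_space) z"
  using cinner_add_right[of x y "- z"] by (simp add: cinner_minus_right)

lemma Re_cinner_commute: "Re (cinner x y) = Re (cinner (y::'h::chilbert_space) x)"
  using cinner_commute[of x y] by simp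

lemma norm_sq_cinner: "(norm (x::'h::chilbert_space))\<^sup>2 = Re (cinner x x)"
  by (simp add: cinner_self)

lemma norm_sq_add:
  "(norm ((x::'h::chilbert_space) + y))\<^sup>2 = (norm x)\<^sup>2 + 2 * Re (cinner x y) + (norm y)\<^sup>2"
  using Re_cinner_commute[of x y]
  by (simp only: norm_sq_cinner cinner_add_left cinner_add_right) simp

lemma norm_sq_diff:
  "(norm ((x::'h::chilbert_space) - y))\<^sup>2 = (norm x)\<^sup>2 - 2 * Re (cinner x y) + (norm y)\<^sup>2"
  using Re_cinner_commute[of x y]
  by (simp only: norm_sq_cinner cinner_diff_left cinner_diff_right) simp

lemma Re_cinner_le: "Re (cinner x y) \<le> norm x * norm (y::'h::chilbert_space)"
proof -
  have "(norm (x + y))\<^sup>2 \<le> (norm x + norm y)\<^sup>2"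
    by (intro power_mono norm_triangle_ineq) auto
  then show ?thesis
    by (simp add: norm_sq_add power2_sum)
qed

lemma norm_scaleC: "norm (c *\<^sub>C (x::'h::chilbert_space)) = cmod c * norm x"
proof -
  have "complex_of_real ((norm (c *\<^sub>C x))\<^sup>2) = c * cnj c * complex_of_real ((norm x)\<^sup>2)"
    by (simp only: cinner_self[symmetric] cinner_scaleC_left cinner_scaleC_right) simp
  also have "\<dots> = complex_of_real ((cmod c * norm x)\<^sup>2)"
    by (simp add: complex_norm_square[symmetric] power_mult_distrib)
  finally have "(norm (c *\<^sub>C x))\<^sup>2 = (cmod c * norm x)\<^sup>2"
    by (simp only: of_real_eq_iff)
  then show ?thesis
    by simp
qed

lemma cinner_ext:
  assumes "\<And>x. cinner x y = cinner x z"
  shows "y = (z::'h::chilbert_space)"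
proof -
  have "(norm (y - z))\<^sup>2 = 0"
    using assms[of "y - z"] by (simp only: norm_sq_cinner cinner_diff_right) simp
  then show ?thesis by simp
qed

text \<open>
  The Riesz representation theorem, by minimising \<open>\<lambda>x. (norm x)\<^sup>2 - 2 * Re (f x)\<close>.
\<close>

lemma riesz_representation:
  fixes f :: "'h::chilbert_space \<Rightarrow> complex"
  assumes "bounded_linear f" and fC: "\<And>c x. f (c *\<^sub>C x) = c * f x"
  shows "\<exists>y. \<forall>x. f x = cinner x y"
proof -
  interpret f: bounded_linear f by fact
  define g where "g x = (norm x)\<^sup>2 - 2 * Re (f x)" for x
  obtain K where K: "\<And>x. norm (f x) \<le> norm x * K"
    using f.bounded by blast
  have lower: "g x \<ge> - K\<^sup>2" for x
  proof -
    have "Re (f x) \<le> norm x * K"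
      using complex_Re_le_cmod[of "f x"] K[of x] by linarith
    moreover have "(norm x - K)\<^sup>2 \<ge> 0" by simp
    ultimately show ?thesis
      unfolding g_def power2_diff by linarith
  qed
  define I where "I = (INF x. g x)"
  have bdd: "bdd_below (range g)"
    using lower by (meson bdd_belowI2)
  have I_le: "I \<le> g x" for x
    unfolding I_def by (rule cINF_lower[OF bdd]) simp
  have "\<exists>x. g x < I + inverse (real (Suc n))" for n
  proof -
    have "I < I + inverse (real (Suc n))" by simp
    then show ?thesis
      unfolding I_def using cINF_less_iff[OF _ bdd] by blast
  qed
  then obtain X where X: "\<And>n. g (X n) < I + inverse (real (Suc n))"
    by metis
  have para: "(norm (x - y))\<^sup>2 \<le> 2 * (g x - I) + 2 * (g y - I)" for x y
  proof -
    have "g ((1/2) *\<^sub>R (x + y)) = (norm (x + y))\<^sup>2 / 4 - Re (f x) - Re (f y)"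
      by (simp add: g_def f.scaleR f.add power_divide add_divide_distrib del: scaleR_add_right)
    with I_le[of "(1/2) *\<^sub>R (x + y)"]
    have "4 * I \<le> (norm (x + y))\<^sup>2 - 4 * Re (f x) - 4 * Re (f y)"
      by linarith
    then show ?thesis
      unfolding g_def norm_sq_add norm_sq_diff by argo
  qed
  have "Cauchy X"
  proof (rule metric_CauchyI)
    fix e :: real assume "e > 0"
    then have "e\<^sup>2 / 4 > 0" by simp
    then obtain N where N: "inverse (real (Suc N)) < e\<^sup>2 / 4"
      using reals_Archimedean by blast
    have close: "g (X n) - I < e\<^sup>2 / 4" if "n \<ge> N" for n
    proof -
      have "inverse (real (Suc n)) \<le> inverse (real (Suc N))"
        using that by (intro le_imp_inverse_le) auto
      with X[of n] N show ?thesis by linarith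
    qed
    show "\<exists>M. \<forall>m\<ge>M. \<forall>n\<ge>M. dist (X m) (X n) < e"
    proof (intro exI[of _ N] allI impI)
      fix m n assume "m \<ge> N" "n \<ge> N"
      then have "(norm (X m - X n))\<^sup>2 < e\<^sup>2"
        using para[of "X m" "X n"] close[of m] close[of n] by argo
      then show "dist (X m) (X n) < e"
        using \<open>e > 0\<close> by (simp add: dist_norm power_less_imp_less_base)
    qed
  qed
  then obtain y where y: "X \<longlonglongrightarrow> y"
    using Cauchy_convergent convergent_def by blast
  have "(\<lambda>n. g (X n)) \<longlonglongrightarrow> g y"
    unfolding g_def by (intro tendsto_intros f.tendsto y)
  moreover have "(\<lambda>n. I + inverse (real (Suc n))) \<longlonglongrightarrow> I + 0"
    by (intro tendsto_intros LIMSEQ_inverse_real_of_nat)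
  ultimately have "g y \<le> I + 0"
    by (rule LIMSEQ_le) (use X in \<open>auto intro: less_imp_le\<close>)
  then have y_min: "g y \<le> g x" for x
    using I_le[of x] by linarith
  have Re_eq: "Re (f x) = Re (cinner x y)" for x
  proof -
    define d where "d = Re (cinner x y) - Re (f x)"
    have pos: "0 \<le> 2 * t * d + t\<^sup>2 * (norm x)\<^sup>2" for t
    proof -
      have "g (y + t *\<^sub>R x) = g y + (2 * t * d + t\<^sup>2 * (norm x)\<^sup>2)"
        using Re_cinner_commute[of y x]
        by (simp add: g_def d_def norm_sq_add f.add f.scaleR cinner_scaleR_right
            power_mult_distrib algebra_simps)
      with y_min[of "y + t *\<^sub>R x"] show ?thesis by linarith
    qed
    have "d = 0"
    proof (rule ccontr)
      assume "d \<noteq> 0"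
      define s where "s = (norm x)\<^sup>2 + 1"
      have s: "s > 0" by (simp add: s_def add_nonneg_pos)
      have "0 \<le> 2 * (- d / s) * d + (- d / s)\<^sup>2 * (norm x)\<^sup>2"
        by (rule pos)
      also have "\<dots> \<le> 2 * (- d / s) * d + (- d / s)\<^sup>2 * s"
        by (intro add_left_mono mult_left_mono) (auto simp: s_def)
      also have "\<dots> = - (d\<^sup>2 / s)"
        using s by (simp add: field_simps power2_eq_square)
      finally have "d\<^sup>2 / s \<le> 0" by simp
      moreover have "d\<^sup>2 / s > 0" using s \<open>d \<noteq> 0\<close> by simp
      ultimately show False by linarith
    qed
    then show ?thesis by (simp add: d_def)
  qed
  have "f x = cinner x y" for x
  proof (rule complex_eqI)
    show "Re (f x) = Re (cinner x y)" by (rule Re_eq)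
    show "Im (f x) = Im (cinner x y)"
      using Re_eq[of "\<i> *\<^sub>C x"] by (simp add: fC cinner_scaleC_left)
  qed
  then show ?thesis by blast
qed

lemma bounded_clinear_adjoint_exists:
  fixes T :: "'h::chilbert_space \<Rightarrow> 'h"
  assumes "bounded_clinear T"
  shows "\<exists>S. bounded_clinear S \<and> (\<forall>x y. cinner (T x) y = cinner x (S y))"
proof -
  interpret T: bounded_linear T
    using assms by (simp add: bounded_clinear_def)
  have TC: "T (c *\<^sub>C x) = c *\<^sub>C T x" for c x
    using assms by (simp add: bounded_clinear_def)
  obtain K where K: "K > 0" "\<And>x. norm (T x) \<le> norm x * K"
    using T.pos_bounded by blast
  have "\<exists>z. \<forall>x. cinner (T x) y = cinner x z" for y
  proof (rule riesz_representation)
    show "bounded_linear (\<lambda>x. cinner (T x) y)"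
    proof (rule bounded_linear_intro)
      fix x
      define w where "w = cinner (T x) y"
      have "(cmod w)\<^sup>2 = Re (cinner (cnj w *\<^sub>C T x) y)"
        by (simp only: cmod_power2 cinner_scaleC_left w_def[symmetric]) (simp add: power2_eq_square)
      also have "\<dots> \<le> norm (cnj w *\<^sub>C T x) * norm y"
        by (rule Re_cinner_le)
      finally have "cmod w * cmod w \<le> cmod w * (norm (T x) * norm y)"
        by (simp add: norm_scaleC power2_eq_square)
      then have "cmod w \<le> norm (T x) * norm y"
        by (cases "w = 0") auto
      also have "\<dots> \<le> norm x * K * norm y"
        by (intro mult_right_mono K) auto
      finally show "norm (cinner (T x) y) \<le> norm x * (K * norm y)"
        by (simp add: w_def)
    qed (simp_all add: T.add T.scaleR cinner_add_left cinner_scaleR_left scaleR_conv_of_real)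
  qed (simp add: TC cinner_scaleC_left)
  then obtain S where S: "\<And>x y. cinner (T x) y = cinner x (S y)"
    by metis
  have SC: "S (c *\<^sub>C y) = c *\<^sub>C S y" for c y
    by (rule cinner_ext) (simp add: S[symmetric] cinner_scaleC_right)
  have "bounded_linear S"
  proof (rule bounded_linear_intro)
    show "S (x + y) = S x + S y" for x y
      by (rule cinner_ext) (simp add: S[symmetric] cinner_add_right)
    show "S (r *\<^sub>R x) = r *\<^sub>R S x" for r x
      by (metis SC scaleC_of_real)
    fix y
    have "(norm (S y))\<^sup>2 = Re (cinner (T (S y)) y)"
      by (simp add: S norm_sq_cinner)
    also have "\<dots> \<le> norm (T (S y)) * norm y"
      by (rule Re_cinner_le)
    also have "\<dots> \<le> norm (S y) * K * norm y"
      by (intro mult_right_mono K) auto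
    finally have "norm (S y) * norm (S y) \<le> norm (S y) * (norm y * K)"
      by (simp add: power2_eq_square algebra_simps)
    then show "norm (S y) \<le> norm y * K"
      using K(1) by (cases "S y = 0") auto
  qed
  with S SC show ?thesis
    unfolding bounded_clinear_def by blast
qed

typedef (overloaded) 'h bounded_op = "{T :: 'h::chilbert_space \<Rightarrow> 'h. bounded_clinear T}"
  morphisms op_apply Bounded_Op
  by (intro exI[of _ "\<lambda>x. 0"]) (simp add: bounded_clinear_def)

setup_lifting type_definition_bounded_op

lemma bounded_op_eqI: "(\<And>x. op_apply S x = op_apply T x) \<Longrightarrow> S = T"
  by (simp add: op_apply_inject[symmetric] fun_eq_iff)

instantiation bounded_op :: (chilbert_space) complex_vector
begin

lift_definition zero_bounded_op :: "'a bounded_op" is "\<lambda>x. 0"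
  by (simp add: bounded_clinear_def)

lift_definition plus_bounded_op :: "'a bounded_op \<Rightarrow> 'a bounded_op \<Rightarrow> 'a bounded_op"
  is "\<lambda>S T x. S x + T x"
  by (auto simp: bounded_clinear_def scaleC_add_right intro: bounded_linear_add)

lift_definition uminus_bounded_op :: "'a bounded_op \<Rightarrow> 'a bounded_op" is "\<lambda>T x. - T x"
  by (auto simp: bounded_clinear_def intro: bounded_linear_minus)

lift_definition minus_bounded_op :: "'a bounded_op \<Rightarrow> 'a bounded_op \<Rightarrow> 'a bounded_op"
  is "\<lambda>S T x. S x - T x"
  by (auto simp: bounded_clinear_def complex_vector.scale_right_diff_distrib
      intro: bounded_linear_sub)

lift_definition scaleC_bounded_op :: "complex \<Rightarrow> 'a bounded_op \<Rightarrow> 'a bounded_op"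
  is "\<lambda>c T x. c *\<^sub>C T x"
proof -
  fix c and T :: "'a \<Rightarrow> 'a"
  assume T: "bounded_clinear T"
  have "bounded_linear (\<lambda>x::'a. c *\<^sub>C x)"
    by (rule bounded_linear_intro[where K = "cmod c"])
      (simp_all add: scaleC_add_right norm_scaleC scaleC_of_real[symmetric] scaleC_scaleC
        mult.commute)
  with T show "bounded_clinear (\<lambda>x. c *\<^sub>C T x)"
    by (auto simp: bounded_clinear_def scaleC_scaleC mult.commute
        intro: bounded_linear_compose)
qed

definition scaleR_bounded_op :: "real \<Rightarrow> 'a bounded_op \<Rightarrow> 'a bounded_op" where
  "scaleR_bounded_op r T = complex_of_real r *\<^sub>C T"

instance
  by standard
    (unfold scaleR_bounded_op_def, (transfer; simp add: fun_eq_iff scaleC_add_right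
      scaleC_add_left scaleC_scaleC)+)

end

instantiation bounded_op :: (chilbert_space) complex_star_algebra
begin

lift_definition times_bounded_op :: "'a bounded_op \<Rightarrow> 'a bounded_op \<Rightarrow> 'a bounded_op"
  is "\<lambda>S T x. S (T x)"
  by (auto simp: bounded_clinear_def intro: bounded_linear_compose)

definition star_bounded_op :: "'a bounded_op \<Rightarrow> 'a bounded_op" where
  "star T = (THE S. \<forall>x y. cinner (op_apply T x) y = cinner x (op_apply S y))"

lemma cinner_op_apply_left: "cinner (op_apply T x) y = cinner x (op_apply (star T) y)"
proof -
  have "bounded_clinear (op_apply T)"
    using op_apply by blast
  then obtain S where S: "bounded_clinear S" "\<And>x y. cinner (op_apply T x) y = cinner x (S y)"
    using bounded_clinear_adjoint_exists by blast
  have "\<exists>!S. \<forall>x y. cinner (op_apply T x) y = cinner x (op_apply S y)"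
  proof (rule ex1I[of _ "Bounded_Op S"])
    show "\<forall>x y. cinner (op_apply T x) y = cinner x (op_apply (Bounded_Op S) y)"
      using S by (simp add: Bounded_Op_inverse)
    show "S' = Bounded_Op S" if "\<forall>x y. cinner (op_apply T x) y = cinner x (op_apply S' y)" for S'
      using that S by (intro bounded_op_eqI cinner_ext) (metis Bounded_Op_inverse mem_Collect_eq)
  qed
  from theI'[OF this] show ?thesis
    unfolding star_bounded_op_def by blast
qed

lemma cinner_op_apply_right: "cinner x (op_apply T y) = cinner (op_apply (star T) x) y"
  by (metis cinner_commute cinner_op_apply_left)

instance
proof
  fix R S T :: "'a bounded_op" and c :: complex
  show "R * S * T = R * (S * T)" by transfer simp
  show "(R + S) * T = R * T + S * T" by transfer simp
  show "R * (S + T) = R * S + R * T"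
    by transfer (simp add: fun_eq_iff bounded_clinear_def linear_simps)
  show "(c *\<^sub>C S) * T = c *\<^sub>C (S * T)" by transfer simp
  show "S * (c *\<^sub>C T) = c *\<^sub>C (S * T)" by transfer (simp add: bounded_clinear_def)
  note simps = cinner_op_apply_left[symmetric] plus_bounded_op.rep_eq scaleC_bounded_op.rep_eq
    times_bounded_op.rep_eq cinner_add_left cinner_add_right cinner_scaleC_left cinner_scaleC_right
  show "star (S + T) = star S + star T"
    by (intro bounded_op_eqI cinner_ext) (simp add: simps)
  show "star (c *\<^sub>C S) = cnj c *\<^sub>C star S"
    by (intro bounded_op_eqI cinner_ext) (simp add: simps)
  show "star (S * T) = star T * star S"
    by (intro bounded_op_eqI cinner_ext) (simp add: simps)
  show "star (star S) = S"
    by (intro bounded_op_eqI cinner_ext) (simp add: cinner_op_apply_left[symmetric] cinner_op_apply_right[symmetric])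
qed

end

instantiation bounded_op :: (chilbert_space) monoid_mult
begin

lift_definition one_bounded_op :: "'a bounded_op" is "\<lambda>x. x"
  by (simp add: bounded_clinear_def)

instance
  by standard (transfer; simp)+

end

definition partial_isometry :: "'h::chilbert_space bounded_op \<Rightarrow> bool" where
  "partial_isometry U \<longleftrightarrow>
     (\<forall>x. (\<forall>y. op_apply U y = 0 \<longrightarrow> cinner x y = 0) \<longrightarrow> norm (op_apply U x) = norm x)"

definition nondegenerate :: "('a \<Rightarrow> 'h::chilbert_space bounded_op) \<Rightarrow> bool" where
  "nondegenerate \<pi> \<longleftrightarrow> closure (cspan {op_apply (\<pi> a) x | a x. True}) = UNIV"


section \<open>Covariant representations and the matrix algebra\<close>

text \<open>
  A \<open>C*\<close>-dynamical system is a type of class \<^class>\<open>unital_cstar_algebra\<close> together with some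
  \<open>\<delta>\<close> satisfying \<^term>\<open>star_hom \<delta>\<close>; the Hilbert space \<open>H\<close> is the type of vectors.
\<close>

definition covariant_representation ::
  "('a::unital_cstar_algebra \<Rightarrow> 'a) \<Rightarrow> ('a \<Rightarrow> 'h::chilbert_space bounded_op) \<Rightarrow> 'h bounded_op \<Rightarrow> bool"
  where
  "covariant_representation \<delta> \<pi> U \<longleftrightarrow>
     star_hom \<pi> \<and> nondegenerate \<pi> \<and> inj \<pi> \<and>
     partial_isometry U \<and>
     (\<forall>a. U * \<pi> a * star U = \<pi> (\<delta> a)) \<and>
     star U * U \<in> commutant (range \<pi>)"

type_synonym 'a matrix = "nat \<Rightarrow> nat \<Rightarrow> 'a"

definition matrix_algebra :: "('a::unital_cstar_algebra \<Rightarrow> 'a) \<Rightarrow> 'a matrix set" where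
  "matrix_algebra \<delta> =
     {a. (\<forall>i j. a i j \<in> {(\<delta> ^^ i) 1 * x * (\<delta> ^^ j) 1 | x. True}) \<and>
         finite {(i, j). a i j \<noteq> 0}}"

definition mat_add :: "'a::unital_cstar_algebra matrix \<Rightarrow> 'a matrix \<Rightarrow> 'a matrix" where
  "mat_add a b = (\<lambda>m n. a m n + b m n)"

definition mat_scale :: "complex \<Rightarrow> 'a::unital_cstar_algebra matrix \<Rightarrow> 'a matrix" where
  "mat_scale c a = (\<lambda>m n. c *\<^sub>C a m n)"

definition mat_star :: "'a::unital_cstar_algebra matrix \<Rightarrow> 'a matrix" where
  "mat_star a = (\<lambda>m n. star (a n m))"

text \<open>
  \<^const>\<open>Sum_any\<close> is the sum over the support. For matrices in \<open>matrix_algebra \<delta>\<close> the support is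
  finite in each use below: in \<open>mat_prod\<close> because one factor of each product in \<open>mat_mult\<close> has
  finitely many non-zero entries, in \<open>mat_series\<close> because the \<open>(m, n)\<close> entry of
  \<open>(shift \<delta> ^^ j) b\<close> vanishes for \<open>j > min m n\<close>.
\<close>

definition mat_prod :: "'a::unital_cstar_algebra matrix \<Rightarrow> 'a matrix \<Rightarrow> 'a matrix" where
  "mat_prod a b = (\<lambda>m n. Sum_any (\<lambda>k. a m k * b k n))"

definition shift :: "('a::unital_cstar_algebra \<Rightarrow> 'a) \<Rightarrow> 'a matrix \<Rightarrow> 'a matrix" where
  "shift \<delta> a = (\<lambda>i j. if i \<ge> 1 \<and> j \<ge> 1 then \<delta> (a (i - 1) (j - 1)) else 0)"

definition mat_series :: "(nat \<Rightarrow> 'a::unital_cstar_algebra matrix) \<Rightarrow> 'a matrix" where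
  "mat_series F = (\<lambda>m n. Sum_any (\<lambda>j. F j m n))"

definition mat_mult ::
  "('a::unital_cstar_algebra \<Rightarrow> 'a) \<Rightarrow> 'a matrix \<Rightarrow> 'a matrix \<Rightarrow> 'a matrix" where
  "mat_mult \<delta> a b =
     mat_add (mat_prod a (mat_series (\<lambda>j. (shift \<delta> ^^ j) b)))
             (mat_prod (mat_series (\<lambda>j. (shift \<delta> ^^ Suc j) a)) b)"

definition mat_embed :: "'a::unital_cstar_algebra \<Rightarrow> 'a matrix" where
  "mat_embed a = (\<lambda>m n. if m = 0 \<and> n = 0 then a else 0)"

definition mat_u :: "('a::unital_cstar_algebra \<Rightarrow> 'a) \<Rightarrow> 'a matrix" where
  "mat_u \<delta> = (\<lambda>m n. if m = 0 \<and> n = 1 then \<delta> 1 else 0)"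

definition matrix_star_hom ::
  "('a::unital_cstar_algebra \<Rightarrow> 'a) \<Rightarrow> ('a matrix \<Rightarrow> 'b::complex_star_algebra) \<Rightarrow> bool" where
  "matrix_star_hom \<delta> \<Psi> \<longleftrightarrow>
     (\<forall>a\<in>matrix_algebra \<delta>. \<forall>b\<in>matrix_algebra \<delta>. \<Psi> (mat_add a b) = \<Psi> a + \<Psi> b) \<and>
     (\<forall>c. \<forall>a\<in>matrix_algebra \<delta>. \<Psi> (mat_scale c a) = c *\<^sub>C \<Psi> a) \<and>
     (\<forall>a\<in>matrix_algebra \<delta>. \<forall>b\<in>matrix_algebra \<delta>. \<Psi> (mat_mult \<delta> a b) = \<Psi> a * \<Psi> b) \<and>
     (\<forall>a\<in>matrix_algebra \<delta>. \<Psi> (mat_star a) = star (\<Psi> a))"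

definition C0_star ::
  "('a::unital_cstar_algebra \<Rightarrow> 'h::chilbert_space bounded_op) \<Rightarrow> 'h bounded_op \<Rightarrow> 'h bounded_op set"
  where
  "C0_star \<pi> U = generated_star_algebra (insert U (range \<pi>))"

definition matrix_representation ::
  "('a::unital_cstar_algebra \<Rightarrow> 'a) \<Rightarrow> ('a \<Rightarrow> 'h::chilbert_space bounded_op) \<Rightarrow> 'h bounded_op
     \<Rightarrow> ('a matrix \<Rightarrow> 'h bounded_op) \<Rightarrow> bool" where
  "matrix_representation \<delta> \<pi> U \<Psi> \<longleftrightarrow>
     matrix_star_hom \<delta> \<Psi> \<and>
     \<Psi> ` matrix_algebra \<delta> = C0_star \<pi> U \<and>
     (\<forall>a. \<Psi> (mat_embed a) = \<pi> a) \<and>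
     \<Psi> (mat_u \<delta>) = U"

definition matrix_sum ::
  "('a::unital_cstar_algebra \<Rightarrow> 'h::chilbert_space bounded_op) \<Rightarrow> 'h bounded_op
     \<Rightarrow> 'a matrix \<Rightarrow> 'h bounded_op" where
  "matrix_sum \<pi> U a = Sum_any (\<lambda>(m, n). star U ^ m * \<pi> (a m n) * U ^ n)"

end

theory Submission
  imports Defs
begin

text \<open>
  Everything rests on three relations between \<open>\<pi>\<close> and \<open>U\<close>. Since \<open>\<pi>\<close> is non-degenerate,
  \<open>\<pi> 1 = 1\<close>, so the covariance condition at the unit gives \<open>U U\<^sup>* = \<pi> (\<delta> 1)\<close>; this is a projection,
  whence \<open>U U\<^sup>* U = U\<close>. Because \<open>U\<^sup>* U\<close> commutes with \<open>\<pi> a\<close>, it follows that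
  \<open>U \<pi>(a) = U (U\<^sup>* U) \<pi>(a) = U \<pi>(a) U\<^sup>* U = \<pi> (\<delta> a) U\<close>, and by induction
  \<open>U\<^sup>n \<pi>(a) = \<pi> (\<delta>\<^sup>n a) U\<^sup>n\<close>, \<open>U\<^sup>n U\<^sup>*\<^sup>n = \<pi> (\<delta>\<^sup>n 1)\<close>.

  A matrix with the single non-zero entry \<open>x\<close> at \<open>(m, n)\<close> stands for the word \<open>U\<^sup>*\<^sup>m \<pi>(x) U\<^sup>n\<close>. In a
  product \<open>(U\<^sup>*\<^sup>m \<pi>(x) U\<^sup>k) (U\<^sup>*\<^sup>l \<pi>(y) U\<^sup>n)\<close> the middle part \<open>U\<^sup>k U\<^sup>*\<^sup>l\<close> reduces to a
  projection \<open>\<pi> (\<delta>\<^sup>j 1)\<close> with \<open>j = min k l\<close>, times the excess power of \<open>U\<close> or \<open>U\<^sup>*\<close>. The projection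
  is absorbed by \<open>x\<close> or \<open>y\<close>, because the entries of a matrix in the algebra lie in the corners
  \<open>\<delta>\<^sup>m(1) A \<delta>\<^sup>n(1)\<close>; the excess power is moved outwards past \<open>y\<close> or \<open>x\<close> at the price of applying
  \<open>\<delta>\<close>. This is exactly what the product of the matrix algebra does with elementary matrices
  (\<open>mat_mult_mat_unit\<close>, \<open>matrix_sum_mult_mat_unit\<close>). Elementary matrices span the algebra
  (\<open>matrix_algebra_induct\<close>) and all operations are additive, so \<open>matrix_sum \<pi> U\<close> is a
  \<open>*\<close>-homomorphism, and its range is a \<open>*\<close>-algebra. That range contains \<open>\<pi> a\<close> and \<open>U\<close> and consists
  of sums of words in them and \<open>U\<^sup>*\<close>, so it is the generated \<open>*\<close>-algebra.

  For uniqueness, an elementary matrix is itself the word \<open>u\<^sup>*\<^sup>m x u\<^sup>n\<close> in the matrix algebra, so the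
  values on the embedded copy of \<open>A\<close> and on \<open>u\<close> determine a \<open>*\<close>-homomorphism
  (\<open>matrix_representation_mat_unit\<close>).
\<close>

section \<open>Preliminaries on \<open>*\<close>-algebras and \<open>*\<close>-homomorphisms\<close>

lemma power_split: "k \<le> n \<Longrightarrow> x ^ n = x ^ (n - k) * x ^ k" "k \<le> n \<Longrightarrow> x ^ n = x ^ k * x ^ (n - k)"
  for x :: "'a :: monoid_mult"
  by (simp_all flip: power_add)

lemma star_one: "star 1 = (1 :: 'a :: {complex_star_algebra, monoid_mult})"
  by (metis mult.left_neutral star_mult star_star)

lemma star_zero: "star 0 = (0 :: 'a :: complex_star_algebra)"
  using star_add[of 0 "0 :: 'a"] by simp

lemma star_power: "star (x ^ n) = star x ^ n"
  for x :: "'a :: {complex_star_algebra, monoid_mult}"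
  by (induction n) (simp_all add: star_one star_mult power_commutes)

lemma star_hom_add: "star_hom f \<Longrightarrow> f (x + y) = f x + f y"
  and star_hom_scaleC: "star_hom f \<Longrightarrow> f (c *\<^sub>C x) = c *\<^sub>C f x"
  and star_hom_mult: "star_hom f \<Longrightarrow> f (x * y) = f x * f y"
  and star_hom_star: "star_hom f \<Longrightarrow> f (star x) = star (f x)"
  by (auto simp: star_hom_def)

lemma star_hom_zero: "star_hom f \<Longrightarrow> f 0 = 0"
  using star_hom_add[of f 0 0] by simp

lemma star_hom_funpow: "star_hom \<delta> \<Longrightarrow> star_hom (\<delta> ^^ n)"
  for \<delta> :: "'a::complex_star_algebra \<Rightarrow> 'a"
  by (induction n) (auto simp: star_hom_def)

section \<open>Matrices with a single non-zero entry\<close>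

definition mat_unit :: "nat \<Rightarrow> nat \<Rightarrow> 'a::unital_cstar_algebra \<Rightarrow> 'a matrix" where
  "mat_unit m n x = (\<lambda>i j. if i = m \<and> j = n then x else 0)"

definition mat_zero :: "'a::unital_cstar_algebra matrix" where
  "mat_zero = (\<lambda>i j. 0)"

lemma mat_star_add: "mat_star (mat_add a b) = mat_add (mat_star a) (mat_star b)"
  by (simp add: mat_star_def mat_add_def star_add)

lemma mat_star_zero: "mat_star mat_zero = mat_zero"
  by (simp add: mat_star_def mat_zero_def star_zero)

lemma mat_scale_add: "mat_scale c (mat_add a b) = mat_add (mat_scale c a) (mat_scale c b)"
  by (simp add: mat_scale_def mat_add_def scaleC_add_right)

lemma mat_scale_mat_zero: "mat_scale c mat_zero = mat_zero"
  by (simp add: mat_scale_def mat_zero_def)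

lemma mat_scale_zero: "mat_scale 0 a = mat_zero"
  by (simp add: mat_scale_def mat_zero_def)

lemma mat_scale_mat_unit: "mat_scale c (mat_unit m n x) = mat_unit m n (c *\<^sub>C x)"
  by (auto simp: mat_scale_def mat_unit_def fun_eq_iff)

lemma mat_star_mat_unit: "mat_star (mat_unit m n x) = mat_unit n m (star x)"
  by (auto simp: mat_star_def mat_unit_def fun_eq_iff star_zero)

lemma mat_embed_eq_mat_unit: "mat_embed = mat_unit 0 0"
  by (simp add: mat_embed_def mat_unit_def fun_eq_iff)

lemma mat_u_eq_mat_unit: "mat_u \<delta> = mat_unit 0 1 (\<delta> 1)"
  by (simp add: mat_u_def mat_unit_def)

lemma mat_prod_mat_unit_left:
  "mat_prod (mat_unit m k x) b = (\<lambda>p q. if p = m then x * b k q else 0)"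
proof (intro ext)
  fix p q
  have "(\<lambda>i. mat_unit m k x p i * b i q) = (\<lambda>i. if i = k then (if p = m then x * b i q else 0) else 0)"
    by (auto simp: mat_unit_def)
  then show "mat_prod (mat_unit m k x) b p q = (if p = m then x * b k q else 0)"
    by (simp only: mat_prod_def Sum_any.delta)
qed

lemma mat_prod_mat_unit_right:
  "mat_prod a (mat_unit l n y) = (\<lambda>p q. if q = n then a p l * y else 0)"
proof (intro ext)
  fix p q
  have "(\<lambda>i. a p i * mat_unit l n y i q) = (\<lambda>i. if i = l then (if q = n then a p i * y else 0) else 0)"
    by (auto simp: mat_unit_def)
  then show "mat_prod a (mat_unit l n y) p q = (if q = n then a p l * y else 0)"
    by (simp only: mat_prod_def Sum_any.delta)
qed

section \<open>Corners\<close>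

text \<open>
  For a \<open>*\<close>-endomorphism \<open>\<delta>\<close> of \<open>A\<close> this is \<open>\<delta>\<^sup>m(1) A \<delta>\<^sup>n(1)\<close> (\<open>corner_iff\<close>). Describing it by
  equations instead of by a factorisation makes its closure properties equational.
\<close>

definition corner :: "('a::unital_cstar_algebra \<Rightarrow> 'a) \<Rightarrow> nat \<Rightarrow> nat \<Rightarrow> 'a set" where
  "corner \<delta> m n = {x. (\<delta> ^^ m) 1 * x = x \<and> x * (\<delta> ^^ n) 1 = x}"

lemma corner_zero: "0 \<in> corner \<delta> m n"
  by (simp add: corner_def)

lemma corner_add: "x \<in> corner \<delta> m n \<Longrightarrow> y \<in> corner \<delta> m n \<Longrightarrow> x + y \<in> corner \<delta> m n"
  by (simp add: corner_def distrib_left distrib_right)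

lemma corner_scaleC: "x \<in> corner \<delta> m n \<Longrightarrow> c *\<^sub>C x \<in> corner \<delta> m n"
  by (simp add: corner_def mult_scaleC_left mult_scaleC_right)

lemma corner_mult: "x \<in> corner \<delta> m k \<Longrightarrow> y \<in> corner \<delta> l n \<Longrightarrow> x * y \<in> corner \<delta> m n"
  by (simp add: corner_def mult.assoc) (metis mult.assoc)

context
  fixes \<delta> :: "'a::unital_cstar_algebra \<Rightarrow> 'a"
  assumes \<delta>: "star_hom \<delta>"
begin

lemma funpow_one_idem: "(\<delta> ^^ n) 1 * (\<delta> ^^ n) 1 = (\<delta> ^^ n) 1"
  by (metis \<delta> star_hom_funpow star_hom_mult mult.left_neutral)

lemma corner_iff: "x \<in> corner \<delta> m n \<longleftrightarrow> x \<in> {(\<delta> ^^ m) 1 * y * (\<delta> ^^ n) 1 | y. True}"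
proof
  assume "x \<in> corner \<delta> m n"
  then have "x = (\<delta> ^^ m) 1 * x * (\<delta> ^^ n) 1" by (simp add: corner_def)
  then show "x \<in> {(\<delta> ^^ m) 1 * y * (\<delta> ^^ n) 1 | y. True}" by blast
next
  assume "x \<in> {(\<delta> ^^ m) 1 * y * (\<delta> ^^ n) 1 | y. True}"
  then obtain y where x: "x = (\<delta> ^^ m) 1 * y * (\<delta> ^^ n) 1" by blast
  have "(\<delta> ^^ m) 1 * x = ((\<delta> ^^ m) 1 * (\<delta> ^^ m) 1) * y * (\<delta> ^^ n) 1"
    unfolding x by (simp only: mult.assoc)
  moreover have "x * (\<delta> ^^ n) 1 = (\<delta> ^^ m) 1 * y * ((\<delta> ^^ n) 1 * (\<delta> ^^ n) 1)"
    unfolding x by (simp only: mult.assoc)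
  ultimately show "x \<in> corner \<delta> m n"
    unfolding corner_def by (simp add: funpow_one_idem x)
qed

lemma matrix_algebra_iff:
  "a \<in> matrix_algebra \<delta> \<longleftrightarrow> (\<forall>m n. a m n \<in> corner \<delta> m n) \<and> finite {(m, n). a m n \<noteq> 0}"
  by (simp only: matrix_algebra_def corner_iff mem_Collect_eq)

lemma corner_star:
  assumes "x \<in> corner \<delta> m n"
  shows "star x \<in> corner \<delta> n m"
proof -
  have self_adjoint: "star ((\<delta> ^^ k) 1) = (\<delta> ^^ k) 1" for k
    by (metis \<delta> star_hom_funpow star_hom_star star_one)
  show ?thesis
    using assms unfolding corner_def mem_Collect_eq by (metis self_adjoint star_mult)
qed

lemma corner_shift:
  assumes "x \<in> corner \<delta> m n"
  shows "(\<delta> ^^ j) x \<in> corner \<delta> (m + j) (n + j)"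
proof -
  have pow: "(\<delta> ^^ (k + j)) 1 = (\<delta> ^^ j) ((\<delta> ^^ k) 1)" for k
    by (simp add: add.commute[of k] funpow_add)
  show ?thesis
    using assms by (simp add: corner_def pow star_hom_mult[OF star_hom_funpow[OF \<delta>], symmetric])
qed

text \<open>
  The projections \<open>\<delta>\<^sup>n(1)\<close> decrease with \<open>n\<close>: applying \<open>\<delta>\<^sup>n\<close> to \<open>\<delta>(1) 1 = \<delta>(1)\<close> shows that
  \<open>\<delta>\<^sup>n\<^sup>+\<^sup>1(1)\<close> absorbs \<open>\<delta>\<^sup>n(1)\<close>.
\<close>

lemma corner_Suc:
  assumes "x \<in> corner \<delta> m (Suc n)"
  shows "x \<in> corner \<delta> m n"
proof -
  have "(\<delta> ^^ Suc n) 1 * (\<delta> ^^ n) 1 = (\<delta> ^^ Suc n) 1"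
    by (metis \<delta> funpow_Suc_right comp_apply star_hom_funpow star_hom_mult mult.right_neutral)
  then show ?thesis
    using assms unfolding corner_def mem_Collect_eq by (metis mult.assoc)
qed

lemma corner_one: "(\<delta> ^^ n) 1 \<in> corner \<delta> 0 n"
  by (simp add: corner_def funpow_one_idem)

section \<open>Elementary matrices span the matrix algebra\<close>

lemma mat_zero_in: "mat_zero \<in> matrix_algebra \<delta>"
  by (simp add: matrix_algebra_iff mat_zero_def corner_zero)

lemma mat_unit_in: "x \<in> corner \<delta> m n \<Longrightarrow> mat_unit m n x \<in> matrix_algebra \<delta>"
  unfolding matrix_algebra_iff
  by (auto simp: mat_unit_def corner_zero intro: finite_subset[of _ "{(m, n)}"])

lemma mat_add_in:
  assumes "a \<in> matrix_algebra \<delta>" "b \<in> matrix_algebra \<delta>"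
  shows "mat_add a b \<in> matrix_algebra \<delta>"
proof -
  have "{(m, n). mat_add a b m n \<noteq> 0} \<subseteq> {(m, n). a m n \<noteq> 0} \<union> {(m, n). b m n \<noteq> 0}"
    by (auto simp: mat_add_def)
  with assms show ?thesis
    unfolding matrix_algebra_iff
    by (auto simp: mat_add_def corner_add intro: finite_subset)
qed

text \<open>
  Splitting off the non-zero entries one by one, this reduces every additive statement about the
  matrix algebra to elementary matrices.
\<close>

lemma matrix_algebra_induct [consumes 1, case_names zero add]:
  assumes "a \<in> matrix_algebra \<delta>"
    and "P mat_zero"
    and "\<And>m n x b. x \<in> corner \<delta> m n \<Longrightarrow> b \<in> matrix_algebra \<delta> \<Longrightarrow> P b
           \<Longrightarrow> P (mat_add (mat_unit m n x) b)"
  shows "P a"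
  using assms(1)
proof (induction "card {(m, n). a m n \<noteq> 0}" arbitrary: a)
  case 0
  then have "{(m, n). a m n \<noteq> 0} = {}"
    by (simp add: matrix_algebra_iff)
  then have "a = mat_zero" by (auto simp: mat_zero_def fun_eq_iff)
  with assms(2) show ?case by simp
next
  case (Suc k)
  then have fin: "finite {(m, n). a m n \<noteq> 0}" and cor: "\<And>m n. a m n \<in> corner \<delta> m n"
    by (auto simp: matrix_algebra_iff)
  from Suc(2) obtain m n where mn: "a m n \<noteq> 0"
    by (metis (mono_tags, lifting) Collect_empty_eq card.empty case_prodE nat.distinct(1))
  define b where "b = (\<lambda>i j. if i = m \<and> j = n then 0 else a i j)"
  have supp: "{(i, j). b i j \<noteq> 0} = {(i, j). a i j \<noteq> 0} - {(m, n)}"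
    by (auto simp: b_def)
  have b: "b \<in> matrix_algebra \<delta>"
    using fin cor unfolding matrix_algebra_iff supp by (auto simp: b_def corner_zero)
  have "k = card {(i, j). b i j \<noteq> 0}"
    using Suc(2) fin mn unfolding supp by simp
  from Suc(1)[OF this b] have "P (mat_add (mat_unit m n (a m n)) b)"
    by (intro assms(3) cor b)
  moreover have "mat_add (mat_unit m n (a m n)) b = a"
    by (auto simp: mat_add_def mat_unit_def b_def fun_eq_iff)
  ultimately show ?case by simp
qed

lemma mat_scale_in: "a \<in> matrix_algebra \<delta> \<Longrightarrow> mat_scale c a \<in> matrix_algebra \<delta>"
  by (induction rule: matrix_algebra_induct)
    (simp_all add: mat_scale_add mat_scale_mat_zero mat_scale_mat_unit mat_zero_in
      mat_add_in mat_unit_in corner_scaleC)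

lemma mat_star_in: "a \<in> matrix_algebra \<delta> \<Longrightarrow> mat_star a \<in> matrix_algebra \<delta>"
  by (induction rule: matrix_algebra_induct)
    (simp_all add: mat_star_add mat_star_zero mat_star_mat_unit mat_zero_in
      mat_add_in mat_unit_in corner_star)

section \<open>The product of the matrix algebra\<close>

lemma shift_funpow:
  "(shift \<delta> ^^ j) a p q = (if j \<le> p \<and> j \<le> q then (\<delta> ^^ j) (a (p - j) (q - j)) else 0)"
proof (induction j arbitrary: p q)
  case (Suc j)
  then show ?case
    by (cases p; cases q) (auto simp: shift_def star_hom_zero[OF \<delta>])
qed simp

lemma finite_shift_funpow: "finite {j. (shift \<delta> ^^ j) a p q \<noteq> 0}"
  by (rule finite_subset[of _ "{..p}"]) (auto simp: shift_funpow split: if_splits)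

lemma finite_shift_funpow_Suc: "finite {j. (shift \<delta> ^^ Suc j) a p q \<noteq> 0}"
  by (rule finite_subset[of _ "{..p}"]) (auto simp: shift_funpow simp del: funpow.simps split: if_splits)

lemma shift_funpow_add:
  "(shift \<delta> ^^ j) (mat_add a b) p q = (shift \<delta> ^^ j) a p q + (shift \<delta> ^^ j) b p q"
  by (simp add: shift_funpow mat_add_def star_hom_add[OF star_hom_funpow[OF \<delta>]])

lemma finite_row: "a \<in> matrix_algebra \<delta> \<Longrightarrow> finite {k. a m k \<noteq> 0}"
  by (rule finite_subset[of _ "snd ` {(m, n). a m n \<noteq> 0}"])
    (force simp: matrix_algebra_iff)+

lemma finite_column: "a \<in> matrix_algebra \<delta> \<Longrightarrow> finite {k. a k n \<noteq> 0}"
  by (rule finite_subset[of _ "fst ` {(m, n). a m n \<noteq> 0}"])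
    (force simp: matrix_algebra_iff)+

text \<open>
  Sums over the support are additive only when the supports are finite. In the two summands of the
  product this has different reasons: next to \<open>mat_series\<close>, which may have infinitely many non-zero
  entries, it is the row of the left factor, respectively the column of the right factor, that is
  finite.
\<close>

lemma finite_row_prod:
  "a \<in> matrix_algebra \<delta> \<Longrightarrow> finite {k. a m k * s k n \<noteq> 0}"
  by (rule finite_subset[OF _ finite_row[of a m]]) auto

lemma finite_column_prod:
  "a \<in> matrix_algebra \<delta> \<Longrightarrow> finite {k. s m k * a k n \<noteq> 0}"
  by (rule finite_subset[OF _ finite_column[of a n]]) auto

lemma mat_prod_row_add_left:
  "a \<in> matrix_algebra \<delta> \<Longrightarrow> b \<in> matrix_algebra \<delta> \<Longrightarrow>
    mat_prod (mat_add a b) s = mat_add (mat_prod a s) (mat_prod b s)"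
  by (simp add: mat_prod_def mat_add_def distrib_right Sum_any.distrib finite_row_prod)

lemma mat_prod_row_add_right:
  "a \<in> matrix_algebra \<delta> \<Longrightarrow>
    mat_prod a (mat_add s t) = mat_add (mat_prod a s) (mat_prod a t)"
  by (simp add: mat_prod_def mat_add_def distrib_left Sum_any.distrib finite_row_prod)

lemma mat_prod_column_add_right:
  "a \<in> matrix_algebra \<delta> \<Longrightarrow> b \<in> matrix_algebra \<delta> \<Longrightarrow>
    mat_prod s (mat_add a b) = mat_add (mat_prod s a) (mat_prod s b)"
  by (simp add: mat_prod_def mat_add_def distrib_left Sum_any.distrib finite_column_prod)

lemma mat_prod_column_add_left:
  "a \<in> matrix_algebra \<delta> \<Longrightarrow>
    mat_prod (mat_add s t) a = mat_add (mat_prod s a) (mat_prod t a)"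
  by (simp add: mat_prod_def mat_add_def distrib_right Sum_any.distrib finite_column_prod)

lemma mat_series_add:
  shows "mat_series (\<lambda>j. (shift \<delta> ^^ j) (mat_add a b))
       = mat_add (mat_series (\<lambda>j. (shift \<delta> ^^ j) a)) (mat_series (\<lambda>j. (shift \<delta> ^^ j) b))"
    and "mat_series (\<lambda>j. (shift \<delta> ^^ Suc j) (mat_add a b))
       = mat_add (mat_series (\<lambda>j. (shift \<delta> ^^ Suc j) a)) (mat_series (\<lambda>j. (shift \<delta> ^^ Suc j) b))"
  unfolding mat_series_def shift_funpow_add
  by (simp_all only: mat_add_def Sum_any.distrib finite_shift_funpow finite_shift_funpow_Suc)

lemma mat_mult_add_left:
  assumes "a \<in> matrix_algebra \<delta>" "b \<in> matrix_algebra \<delta>" "c \<in> matrix_algebra \<delta>"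
  shows "mat_mult \<delta> (mat_add a b) c = mat_add (mat_mult \<delta> a c) (mat_mult \<delta> b c)"
  unfolding mat_mult_def mat_series_add mat_prod_row_add_left[OF assms(1,2)]
    mat_prod_column_add_left[OF assms(3)]
  by (simp add: mat_add_def ac_simps)

lemma mat_mult_add_right:
  assumes "a \<in> matrix_algebra \<delta>" "b \<in> matrix_algebra \<delta>" "c \<in> matrix_algebra \<delta>"
  shows "mat_mult \<delta> c (mat_add a b) = mat_add (mat_mult \<delta> c a) (mat_mult \<delta> c b)"
  unfolding mat_mult_def mat_series_add mat_prod_column_add_right[OF assms(1,2)]
    mat_prod_row_add_right[OF assms(3)]
  by (simp add: mat_add_def ac_simps)

lemma mat_mult_zero:
  "mat_mult \<delta> mat_zero a = mat_zero" "mat_mult \<delta> a mat_zero = mat_zero"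
proof -
  have prod: "mat_prod mat_zero b = mat_zero" "mat_prod b mat_zero = mat_zero" for b :: "'a matrix"
    by (simp_all add: mat_prod_def mat_zero_def)
  have shift: "(shift \<delta> ^^ j) mat_zero = mat_zero" for j
    by (intro ext) (simp add: shift_funpow mat_zero_def star_hom_zero[OF star_hom_funpow[OF \<delta>]])
  have "mat_series (\<lambda>j. mat_zero :: 'a matrix) = mat_zero"
    by (simp add: mat_series_def mat_zero_def)
  with prod show "mat_mult \<delta> mat_zero a = mat_zero" "mat_mult \<delta> a mat_zero = mat_zero"
    unfolding mat_mult_def shift by (simp_all add: mat_add_def mat_zero_def)
qed

lemma if_nested: "P \<longleftrightarrow> Q \<and> R \<Longrightarrow> (if P then s else t) = (if Q then if R then s else t else t)"
  by simp

lemma shift_funpow_mat_unit: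
  "(shift \<delta> ^^ j) (mat_unit m n x) = mat_unit (m + j) (n + j) ((\<delta> ^^ j) x)"
proof (intro ext)
  fix p q
  show "(shift \<delta> ^^ j) (mat_unit m n x) p q = mat_unit (m + j) (n + j) ((\<delta> ^^ j) x) p q"
    unfolding shift_funpow mat_unit_def
      if_distrib[of "\<delta> ^^ j"] star_hom_zero[OF star_hom_funpow[OF \<delta>]]
    by (rule if_nested[symmetric]) auto
qed

lemma mat_series_mat_unit:
  "mat_series (\<lambda>j. (shift \<delta> ^^ j) (mat_unit l n y)) p q
     = (if l \<le> p \<and> q = n + (p - l) then (\<delta> ^^ (p - l)) y else 0)"
proof -
  have "(shift \<delta> ^^ j) (mat_unit l n y) p q
      = (if j = p - l then if l \<le> p \<and> q = n + (p - l) then (\<delta> ^^ j) y else 0 else 0)" for j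
    unfolding shift_funpow_mat_unit unfolding mat_unit_def by (rule if_nested) auto
  then show ?thesis by (simp only: mat_series_def Sum_any.delta)
qed

lemma mat_series_Suc_mat_unit:
  "mat_series (\<lambda>j. (shift \<delta> ^^ Suc j) (mat_unit m k x)) p q
     = (if m < p \<and> q = k + (p - m) then (\<delta> ^^ (p - m)) x else 0)"
proof -
  \<comment> \<open>The \<open>j\<close>-th term is \<open>\<Lambda>\<^sup>j\<^sup>+\<^sup>1\<close>, so row \<open>p\<close> is reached at \<open>j + 1 = p - m\<close>.\<close>
  have "(shift \<delta> ^^ Suc j) (mat_unit m k x) p q
      = (if j = p - Suc m then if m < p \<and> q = k + (p - m) then (\<delta> ^^ Suc j) x else 0 else 0)" for j
    unfolding shift_funpow_mat_unit unfolding mat_unit_def by (rule if_nested) auto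
  then have "mat_series (\<lambda>j. (shift \<delta> ^^ Suc j) (mat_unit m k x)) p q
      = (if m < p \<and> q = k + (p - m) then (\<delta> ^^ Suc (p - Suc m)) x else 0)"
    by (simp only: mat_series_def Sum_any.delta)
  moreover have "m < p \<Longrightarrow> Suc (p - Suc m) = p - m"
    by simp
  ultimately show ?thesis by (simp only: cong: if_cong)
qed

text \<open>
  Read as words, \<open>(u\<^sup>*\<^sup>m x u\<^sup>k) (u\<^sup>*\<^sup>l y u\<^sup>n)\<close>: the factor with the smaller inner exponent is the one
  that is shifted. In \<open>a \<cdot> \<Lambda>\<^sup>j(b)\<close> the inner indices \<open>k\<close> and \<open>l + j\<close> meet only for \<open>j = k - l \<ge> 0\<close>, and
  in \<open>\<Lambda>\<^sup>j(a) \<cdot> b\<close>, where \<open>j \<ge> 1\<close>, only for \<open>j = l - k > 0\<close>; so at most one summand is non-zero.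
\<close>

lemma mat_mult_mat_unit:
  "mat_mult \<delta> (mat_unit m k x) (mat_unit l n y)
     = (if l \<le> k then mat_unit m (n + (k - l)) (x * (\<delta> ^^ (k - l)) y)
        else mat_unit (m + (l - k)) n ((\<delta> ^^ (l - k)) x * y))"
  unfolding mat_mult_def mat_prod_mat_unit_left mat_prod_mat_unit_right mat_series_mat_unit
    mat_series_Suc_mat_unit
  by (auto simp: mat_add_def mat_unit_def fun_eq_iff)

lemma mat_mult_mat_unit_in:
  assumes "x \<in> corner \<delta> m k" "y \<in> corner \<delta> l n"
  shows "mat_mult \<delta> (mat_unit m k x) (mat_unit l n y) \<in> matrix_algebra \<delta>"
  unfolding mat_mult_mat_unit
  using corner_mult[OF assms(1) corner_shift[OF assms(2), of "k - l"]]
    corner_mult[OF corner_shift[OF assms(1), of "l - k"] assms(2)]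
  by (simp only: mat_unit_in split: if_split) simp

lemma mat_mult_in:
  assumes "a \<in> matrix_algebra \<delta>" "b \<in> matrix_algebra \<delta>"
  shows "mat_mult \<delta> a b \<in> matrix_algebra \<delta>"
  using assms(1)
proof (induction rule: matrix_algebra_induct)
  case zero
  then show ?case by (simp add: mat_mult_zero mat_zero_in)
next
  case (add m k x a)
  have "mat_mult \<delta> (mat_unit m k x) b \<in> matrix_algebra \<delta>"
    using assms(2)
  proof (induction rule: matrix_algebra_induct)
    case zero
    then show ?case by (simp add: mat_mult_zero mat_zero_in)
  next
    case (add l n y b)
    then show ?case
      using \<open>x \<in> corner \<delta> m k\<close>
      by (simp add: mat_mult_add_right mat_unit_in mat_add_in mat_mult_mat_unit_in)
  qed
  with add assms(2) show ?case
    by (simp add: mat_mult_add_left mat_unit_in mat_add_in)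
qed

lemma mat_embed_in: "mat_embed a \<in> matrix_algebra \<delta>"
  by (simp add: mat_embed_eq_mat_unit mat_unit_in corner_def)

lemma mat_u_in: "mat_u \<delta> \<in> matrix_algebra \<delta>"
  using corner_one[of 1] by (simp add: mat_u_eq_mat_unit mat_unit_in)

end

section \<open>Covariant representations\<close>

text \<open>The reason is \<open>\<parallel>T\<^sup>* x\<parallel>\<^sup>2 = \<langle>x, T T\<^sup>* x\<rangle>\<close>.\<close>

lemma mult_star_eq_zero_imp:
  fixes T :: "'h::chilbert_space bounded_op"
  assumes "T * star T = 0"
  shows "T = 0"
proof -
  have "cinner (op_apply (star T) x) (op_apply (star T) x) = 0" for x
  proof -
    have "cinner (op_apply (star T) x) (op_apply (star T) x) = cinner x (op_apply (T * star T) x)"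
      by (simp add: cinner_op_apply_left[of "star T"] star_star times_bounded_op.rep_eq)
    also have "\<dots> = cinner x (0 *\<^sub>C x)"
      by (simp add: assms zero_bounded_op.rep_eq)
    finally show ?thesis
      by (simp only: cinner_scaleC_right) simp
  qed
  then have "star T = 0"
    by (intro bounded_op_eqI) (simp add: cinner_self zero_bounded_op.rep_eq)
  then show ?thesis
    by (metis star_star star_zero)
qed

text \<open>
  The fixed vectors of \<open>\<pi> 1\<close> form a closed subspace containing all \<open>\<pi>(a) x\<close>, and these span a dense
  subspace.
\<close>

lemma nondegenerate_one:
  fixes \<pi> :: "'a::unital_cstar_algebra \<Rightarrow> 'h::chilbert_space bounded_op"
  assumes "star_hom \<pi>" "nondegenerate \<pi>"
  shows "\<pi> 1 = 1"
proof -
  let ?F = "{v. op_apply (\<pi> 1) v = v}"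
  have lin: "bounded_clinear (op_apply (\<pi> 1))"
    using op_apply by blast
  then interpret T: bounded_linear "op_apply (\<pi> 1)"
    by (simp add: bounded_clinear_def)
  have sub: "csubspace ?F"
    using lin by (auto simp: complex_vector.subspace_def bounded_clinear_def T.zero T.add)
  have "op_apply (\<pi> 1) (op_apply (\<pi> a) x) = op_apply (\<pi> a) x" for a x
    by (metis assms(1) mult.left_neutral star_hom_mult times_bounded_op.rep_eq)
  then have "{op_apply (\<pi> a) x | a x. True} \<subseteq> ?F"
    by blast
  then have "cspan {op_apply (\<pi> a) x | a x. True} \<subseteq> ?F"
    using sub by (intro complex_vector.span_minimal)
  moreover have "closed ?F"
    by (intro closed_Collect_eq T.continuous_on continuous_on_id)
  ultimately have "closure (cspan {op_apply (\<pi> a) x | a x. True}) \<subseteq> ?F"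
    by (rule closure_minimal)
  then have "op_apply (\<pi> 1) v = v" for v
    using assms(2) by (auto simp: nondegenerate_def)
  then show ?thesis
    by (intro bounded_op_eqI) (simp add: one_bounded_op.rep_eq)
qed

context
  fixes \<delta> :: "'a::unital_cstar_algebra \<Rightarrow> 'a"
    and \<pi> :: "'a \<Rightarrow> 'h::chilbert_space bounded_op"
    and U :: "'h bounded_op"
  assumes \<delta>: "star_hom \<delta>"
    and cov: "covariant_representation \<delta> \<pi> U"
begin

lemma star_hom_\<pi>: "star_hom \<pi>"
  and U_commutes: "star U * U * \<pi> a = \<pi> a * (star U * U)"
  and U_implements: "U * \<pi> a * star U = \<pi> (\<delta> a)"
  and \<pi>_one: "\<pi> 1 = 1"
  using cov nondegenerate_one
  by (auto simp: covariant_representation_def commutant_def)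

lemma U_star_U: "U * star U = \<pi> (\<delta> 1)"
  using U_implements[of 1] by (simp add: \<pi>_one)

text \<open>
  With the projection \<open>P = U U\<^sup>* = \<pi> (\<delta> 1)\<close>, expanding gives \<open>(P U - U) (P U - U)\<^sup>* = 0\<close>.
\<close>

lemma \<delta>_one_U: "\<pi> (\<delta> 1) * U = U"
proof -
  define P where "P = \<pi> (\<delta> 1)"
  have PP: "P * P = P"
    using star_hom_mult[OF \<delta>, of 1 1] star_hom_mult[OF star_hom_\<pi>, of "\<delta> 1" "\<delta> 1"] by (simp add: P_def)
  have star_P: "star P = P"
    unfolding P_def by (simp add: star_one flip: star_hom_star[OF star_hom_\<pi>] star_hom_star[OF \<delta>])
  have "star (P * U - U) + star U = star U * P"
    by (simp add: star_P star_mult flip: star_add)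
  then have "star (P * U - U) = star U * P - star U"
    by (simp add: eq_diff_eq)
  then have "(P * U - U) * star (P * U - U)
      = P * (U * star U) * P - P * (U * star U) - (U * star U) * P + U * star U"
    by (simp add: left_diff_distrib right_diff_distrib mult.assoc)
  also have "\<dots> = 0"
    by (simp add: U_star_U PP flip: P_def)
  finally have "P * U - U = 0"
    by (rule mult_star_eq_zero_imp)
  then show ?thesis
    by (simp add: P_def)
qed

text \<open>
  Insert \<open>U = U U\<^sup>* U\<close> and move \<open>U\<^sup>* U\<close> past \<open>\<pi> a\<close>; what remains on the left is \<open>U \<pi>(a) U\<^sup>*\<close>.
\<close>

lemma U_\<pi>: "U * \<pi> a = \<pi> (\<delta> a) * U"
proof -
  have "U * \<pi> a = U * star U * U * \<pi> a"
    by (simp add: U_star_U \<delta>_one_U)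
  also have "\<dots> = U * \<pi> a * star U * U"
    by (metis U_commutes mult.assoc)
  finally show ?thesis
    by (simp add: U_implements)
qed

lemma power_U_\<pi>: "U ^ n * \<pi> a = \<pi> ((\<delta> ^^ n) a) * U ^ n"
proof (induction n)
  case (Suc n)
  have "U ^ Suc n * \<pi> a = U * (U ^ n * \<pi> a)" by (simp add: mult.assoc)
  also have "\<dots> = (U * \<pi> ((\<delta> ^^ n) a)) * U ^ n" by (simp only: Suc mult.assoc)
  finally show ?case by (simp add: U_\<pi> mult.assoc)
qed simp

lemma \<pi>_power_star_U: "\<pi> a * star U ^ n = star U ^ n * \<pi> ((\<delta> ^^ n) a)"
proof -
  have "star (U ^ n * \<pi> (star a)) = star (\<pi> ((\<delta> ^^ n) (star a)) * U ^ n)"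
    by (simp only: power_U_\<pi>)
  then show ?thesis
    by (simp add: star_mult star_power star_star star_hom_star[OF star_hom_\<pi>]
        star_hom_star[OF star_hom_funpow[OF \<delta>]])
qed

lemma power_U_star: "U ^ n * star U ^ n = \<pi> ((\<delta> ^^ n) 1)"
proof (induction n)
  case (Suc n)
  have "U ^ Suc n * star U ^ Suc n = U * (U ^ n * star U ^ n) * star U"
    unfolding power_Suc[of U] power_Suc2[of "star U"] by (simp only: mult.assoc)
  then show ?case
    by (simp only: Suc U_implements) simp
qed (simp add: \<pi>_one)

section \<open>The homomorphism given by the sum formula\<close>

lemma matrix_sum_zero: "matrix_sum \<pi> U mat_zero = 0"
  by (simp add: matrix_sum_def mat_zero_def star_hom_zero[OF star_hom_\<pi>] case_prod_beta)

lemma matrix_sum_mat_unit: "matrix_sum \<pi> U (mat_unit m n x) = star U ^ m * \<pi> x * U ^ n"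
proof -
  have "(\<lambda>(i, j). star U ^ i * \<pi> (mat_unit m n x i j) * U ^ j)
      = (\<lambda>p. if p = (m, n) then star U ^ m * \<pi> x * U ^ n else 0)"
    by (auto simp: fun_eq_iff mat_unit_def star_hom_zero[OF star_hom_\<pi>])
  then show ?thesis
    by (simp only: matrix_sum_def Sum_any.delta)
qed

lemma matrix_sum_add:
  assumes "a \<in> matrix_algebra \<delta>" "b \<in> matrix_algebra \<delta>"
  shows "matrix_sum \<pi> U (mat_add a b) = matrix_sum \<pi> U a + matrix_sum \<pi> U b"
proof -
  have fin: "finite {p. (case p of (m, n) \<Rightarrow> star U ^ m * \<pi> (c m n) * U ^ n) \<noteq> 0}"
    if "c \<in> matrix_algebra \<delta>" for c
  proof (rule finite_subset)
    show "finite {(m, n). c m n \<noteq> 0}"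
      using that by (simp add: matrix_algebra_iff[OF \<delta>])
  qed (auto simp: star_hom_zero[OF star_hom_\<pi>])
  have "(\<lambda>(m, n). star U ^ m * \<pi> (mat_add a b m n) * U ^ n)
      = (\<lambda>p. (case p of (m, n) \<Rightarrow> star U ^ m * \<pi> (a m n) * U ^ n)
          + (case p of (m, n) \<Rightarrow> star U ^ m * \<pi> (b m n) * U ^ n))"
    by (auto simp: fun_eq_iff mat_add_def star_hom_add[OF star_hom_\<pi>] distrib_left distrib_right)
  then show ?thesis
    by (simp only: matrix_sum_def Sum_any.distrib[OF fin fin] assms)
qed

lemma matrix_sum_scale:
  "a \<in> matrix_algebra \<delta> \<Longrightarrow> matrix_sum \<pi> U (mat_scale c a) = c *\<^sub>C matrix_sum \<pi> U a"
proof (induction rule: matrix_algebra_induct[OF \<delta>, consumes 1, case_names zero add])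
  case zero
  then show ?case by (simp add: mat_scale_mat_zero matrix_sum_zero)
next
  case (add m n x b)
  have "matrix_sum \<pi> U (mat_scale c (mat_unit m n x)) = c *\<^sub>C matrix_sum \<pi> U (mat_unit m n x)"
    by (simp add: mat_scale_mat_unit matrix_sum_mat_unit star_hom_scaleC[OF star_hom_\<pi>]
        mult_scaleC_left mult_scaleC_right)
  with add show ?case
    by (simp add: mat_scale_add matrix_sum_add mat_scale_in[OF \<delta>] mat_unit_in[OF \<delta>] scaleC_add_right)
qed

lemma matrix_sum_star:
  "a \<in> matrix_algebra \<delta> \<Longrightarrow> matrix_sum \<pi> U (mat_star a) = star (matrix_sum \<pi> U a)"
proof (induction rule: matrix_algebra_induct[OF \<delta>, consumes 1, case_names zero add])
  case zero
  then show ?case by (simp add: mat_star_zero matrix_sum_zero star_zero)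
next
  case (add m n x b)
  have "matrix_sum \<pi> U (mat_star (mat_unit m n x)) = star (matrix_sum \<pi> U (mat_unit m n x))"
    by (simp add: mat_star_mat_unit matrix_sum_mat_unit star_hom_star[OF star_hom_\<pi>] star_mult star_power
        star_star mult.assoc)
  with add show ?case
    by (simp add: mat_star_add matrix_sum_add mat_star_in[OF \<delta>] mat_unit_in[OF \<delta>] star_add)
qed

text \<open>
  Since \<open>U\<^sup>j U\<^sup>*\<^sup>j = \<pi> (\<delta>\<^sup>j 1)\<close> is a unit for the neighbouring entry, whose
  corner is cut down by \<open>\<delta>\<^sup>j(1)\<close> on that side, the inner powers cancel up to \<open>U\<^sup>k\<^sup>-\<^sup>l\<close> or
  \<open>U\<^sup>*\<^sup>l\<^sup>-\<^sup>k\<close>, which is then commuted outwards.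
\<close>

lemma matrix_sum_mult_mat_unit:
  assumes "x \<in> corner \<delta> m k" "y \<in> corner \<delta> l n"
  shows "matrix_sum \<pi> U (mat_mult \<delta> (mat_unit m k x) (mat_unit l n y))
    = matrix_sum \<pi> U (mat_unit m k x) * matrix_sum \<pi> U (mat_unit l n y)"
proof (cases "l \<le> k")
  case True
  have y: "\<pi> ((\<delta> ^^ l) 1) * \<pi> y = \<pi> y"
    using assms(2) by (simp add: corner_def flip: star_hom_mult[OF star_hom_\<pi>])
  have "(star U ^ m * \<pi> x * U ^ k) * (star U ^ l * \<pi> y * U ^ n)
      = star U ^ m * \<pi> x * U ^ (k - l) * ((U ^ l * star U ^ l) * \<pi> y) * U ^ n"
    by (simp only: power_split(1)[OF True] mult.assoc)
  also have "\<dots> = star U ^ m * \<pi> x * (U ^ (k - l) * \<pi> y) * U ^ n"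
    by (simp only: power_U_star y mult.assoc)
  also have "\<dots> = star U ^ m * (\<pi> x * \<pi> ((\<delta> ^^ (k - l)) y)) * (U ^ (k - l) * U ^ n)"
    by (simp only: power_U_\<pi> mult.assoc)
  also have "\<dots> = star U ^ m * \<pi> (x * (\<delta> ^^ (k - l)) y) * U ^ (n + (k - l))"
    by (simp only: star_hom_mult[OF star_hom_\<pi>] power_add[symmetric] add.commute[of "k - l" n])
  finally show ?thesis
    using True by (simp only: mat_mult_mat_unit[OF \<delta>] matrix_sum_mat_unit if_True)
next
  case False
  then have kl: "k \<le> l" by simp
  have x: "\<pi> x * \<pi> ((\<delta> ^^ k) 1) = \<pi> x"
    using assms(1) by (simp add: corner_def flip: star_hom_mult[OF star_hom_\<pi>])
  have "(star U ^ m * \<pi> x * U ^ k) * (star U ^ l * \<pi> y * U ^ n)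
      = star U ^ m * (\<pi> x * (U ^ k * star U ^ k)) * star U ^ (l - k) * \<pi> y * U ^ n"
    by (simp only: power_split(2)[OF kl] mult.assoc)
  also have "\<dots> = star U ^ m * (\<pi> x * star U ^ (l - k)) * \<pi> y * U ^ n"
    by (simp only: power_U_star x mult.assoc)
  also have "\<dots> = (star U ^ m * star U ^ (l - k)) * (\<pi> ((\<delta> ^^ (l - k)) x) * \<pi> y) * U ^ n"
    by (simp only: \<pi>_power_star_U mult.assoc)
  also have "\<dots> = star U ^ (m + (l - k)) * \<pi> ((\<delta> ^^ (l - k)) x * y) * U ^ n"
    by (simp only: star_hom_mult[OF star_hom_\<pi>] power_add)
  finally show ?thesis
    using False by (simp only: mat_mult_mat_unit[OF \<delta>] matrix_sum_mat_unit if_False)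
qed

lemma matrix_sum_mult:
  assumes "a \<in> matrix_algebra \<delta>" "b \<in> matrix_algebra \<delta>"
  shows "matrix_sum \<pi> U (mat_mult \<delta> a b) = matrix_sum \<pi> U a * matrix_sum \<pi> U b"
  using assms(1)
proof (induction rule: matrix_algebra_induct[OF \<delta>, consumes 1, case_names zero add])
  case zero
  then show ?case by (simp add: mat_mult_zero[OF \<delta>] matrix_sum_zero)
next
  case (add m k x a)
  note x = \<open>x \<in> corner \<delta> m k\<close>
  have "matrix_sum \<pi> U (mat_mult \<delta> (mat_unit m k x) b)
      = matrix_sum \<pi> U (mat_unit m k x) * matrix_sum \<pi> U b"
    using assms(2)
  proof (induction rule: matrix_algebra_induct[OF \<delta>, consumes 1, case_names zero add])
    case zero
    then show ?case by (simp add: mat_mult_zero[OF \<delta>] matrix_sum_zero)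
  next
    case (add l n y b)
    then show ?case
      using x by (simp add: mat_mult_add_right[OF \<delta>] matrix_sum_add mat_mult_in[OF \<delta>]
          mat_unit_in[OF \<delta>] matrix_sum_mult_mat_unit distrib_left)
  qed
  with add assms(2) show ?case
    by (simp add: mat_mult_add_left[OF \<delta>] matrix_sum_add mat_mult_in[OF \<delta>] mat_unit_in[OF \<delta>]
        distrib_right)
qed

lemma matrix_sum_mat_embed: "matrix_sum \<pi> U (mat_embed a) = \<pi> a"
  by (simp add: mat_embed_eq_mat_unit matrix_sum_mat_unit)

lemma matrix_sum_mat_u: "matrix_sum \<pi> U (mat_u \<delta>) = U"
  by (simp add: mat_u_eq_mat_unit matrix_sum_mat_unit \<delta>_one_U)

section \<open>The generated \<open>*\<close>-algebra and uniqueness\<close>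

lemma star_subalgebra_range_matrix_sum: "star_subalgebra (matrix_sum \<pi> U ` matrix_algebra \<delta>)"
  unfolding star_subalgebra_def complex_vector.subspace_def
proof (intro conjI ballI allI)
  show "0 \<in> matrix_sum \<pi> U ` matrix_algebra \<delta>"
    using mat_zero_in[OF \<delta>] matrix_sum_zero by (metis imageI)
qed (auto simp flip: matrix_sum_add matrix_sum_scale matrix_sum_mult matrix_sum_star
    intro!: imageI mat_add_in[OF \<delta>] mat_scale_in[OF \<delta>] mat_mult_in[OF \<delta>] mat_star_in[OF \<delta>])

lemma matrix_sum_in_star_subalgebra:
  assumes B: "star_subalgebra B" "insert U (range \<pi>) \<subseteq> B" and "a \<in> matrix_algebra \<delta>"
  shows "matrix_sum \<pi> U a \<in> B"
  using assms(3)
proof (induction rule: matrix_algebra_induct[OF \<delta>, consumes 1, case_names zero add])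
  case zero
  then show ?case
    using B(1) by (simp add: matrix_sum_zero star_subalgebra_def complex_vector.subspace_0)
next
  case (add m n x b)
  have mult: "s * t \<in> B" if "s \<in> B" "t \<in> B" for s t
    using B(1) that by (simp add: star_subalgebra_def)
  have one: "1 \<in> B"
    using B(2) \<pi>_one by (metis insert_subset range_subsetD)
  have power: "t ^ i \<in> B" if "t \<in> B" for t i
    using that by (induction i) (simp_all add: one mult)
  have "star U \<in> B"
    using B by (simp add: star_subalgebra_def)
  then have "star U ^ m * \<pi> x * U ^ n \<in> B"
    using B(2) by (intro mult power) auto
  with add show ?case
    using B(1) by (simp add: matrix_sum_add mat_unit_in[OF \<delta>] matrix_sum_mat_unit
        star_subalgebra_def complex_vector.subspace_add)
qed

lemma range_matrix_sum: "matrix_sum \<pi> U ` matrix_algebra \<delta> = C0_star \<pi> U"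
proof
  show "matrix_sum \<pi> U ` matrix_algebra \<delta> \<subseteq> C0_star \<pi> U"
    unfolding C0_star_def generated_star_algebra_def
    using matrix_sum_in_star_subalgebra by blast
  have "U \<in> matrix_sum \<pi> U ` matrix_algebra \<delta>"
    using mat_u_in[OF \<delta>] matrix_sum_mat_u by (metis imageI)
  moreover have "\<pi> a \<in> matrix_sum \<pi> U ` matrix_algebra \<delta>" for a
    using mat_embed_in[OF \<delta>] matrix_sum_mat_embed by (metis imageI)
  ultimately show "C0_star \<pi> U \<subseteq> matrix_sum \<pi> U ` matrix_algebra \<delta>"
    unfolding C0_star_def generated_star_algebra_def
    using star_subalgebra_range_matrix_sum by blast
qed

lemma matrix_representation_matrix_sum: "matrix_representation \<delta> \<pi> U (matrix_sum \<pi> U)"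
  unfolding matrix_representation_def matrix_star_hom_def
  by (simp add: matrix_sum_add matrix_sum_scale matrix_sum_mult matrix_sum_star
      matrix_sum_mat_embed matrix_sum_mat_u range_matrix_sum)

text \<open>
  Only values on the algebra matter since it is closed under all its operations. This transfers the
  representation from \<open>matrix_sum\<close> to its restriction, which is the extensional representative.
\<close>

lemma matrix_representation_cong:
  assumes "\<And>a. a \<in> matrix_algebra \<delta> \<Longrightarrow> \<Phi> a = \<Psi> a"
  shows "matrix_representation \<delta> \<pi> U \<Phi> \<longleftrightarrow> matrix_representation \<delta> \<pi> U \<Psi>"
proof -
  have "\<Phi> ` matrix_algebra \<delta> = \<Psi> ` matrix_algebra \<delta>"
    by (rule image_cong) (simp_all add: assms)
  then show ?thesis
    unfolding matrix_representation_def matrix_star_hom_def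
    by (simp add: assms mat_add_in[OF \<delta>] mat_scale_in[OF \<delta>] mat_mult_in[OF \<delta>]
        mat_star_in[OF \<delta>] mat_embed_in[OF \<delta>] mat_u_in[OF \<delta>] cong: ball_cong)
qed

text \<open>
  Right multiplication by \<open>u\<close> raises the column index of an elementary matrix by one, which
  settles row \<open>0\<close> starting from the embedded copy of \<open>A\<close>. The row index is then raised in the same
  way on the adjoint, where the two indices are swapped. At each step the entry also lies in the
  corner of the smaller index, by \<open>corner_Suc\<close>.
\<close>

lemma matrix_representation_mat_unit:
  assumes \<Psi>: "matrix_representation \<delta> \<pi> U \<Psi>" and "x \<in> corner \<delta> m n"
  shows "\<Psi> (mat_unit m n x) = star U ^ m * \<pi> x * U ^ n"
proof -
  have step: "\<Psi> (mat_unit m (Suc n) x) = \<Psi> (mat_unit m n x) * U"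
    if x: "x \<in> corner \<delta> m (Suc n)" for m n x
  proof -
    have "mat_mult \<delta> (mat_unit m n x) (mat_u \<delta>) = mat_unit m (Suc n) (x * (\<delta> ^^ n) (\<delta> 1))"
      by (simp add: mat_u_eq_mat_unit mat_mult_mat_unit[OF \<delta>])
    moreover have "x * (\<delta> ^^ n) (\<delta> 1) = x"
      using x by (simp add: corner_def funpow_swap1)
    moreover have "\<Psi> (mat_mult \<delta> (mat_unit m n x) (mat_u \<delta>)) = \<Psi> (mat_unit m n x) * U"
      using \<Psi> mat_unit_in[OF \<delta> corner_Suc[OF \<delta> x]] mat_u_in[OF \<delta>]
      by (simp add: matrix_representation_def matrix_star_hom_def)
    ultimately show ?thesis by simp
  qed
  have row: "\<Psi> (mat_unit 0 n x) = \<pi> x * U ^ n" if "x \<in> corner \<delta> 0 n" for n x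
    using that
  proof (induction n)
    case 0
    then show ?case
      using \<Psi> by (simp add: matrix_representation_def flip: mat_embed_eq_mat_unit)
  next
    case (Suc n)
    then have "\<Psi> (mat_unit 0 (Suc n) x) = (\<pi> x * U ^ n) * U"
      using step corner_Suc[OF \<delta>] by simp
    then show ?case by (simp add: mult.assoc power_commutes)
  qed
  have adj: "\<Psi> (mat_unit n m (star x)) = star (\<Psi> (mat_unit m n x))" if "x \<in> corner \<delta> m n" for m n x
    using \<Psi> mat_unit_in[OF \<delta> that]
    by (auto simp: matrix_representation_def matrix_star_hom_def simp flip: mat_star_mat_unit)
  show ?thesis
    using assms(2)
  proof (induction m)
    case 0
    then show ?case by (simp add: row)
  next
    case (Suc m)
    have sx: "star x \<in> corner \<delta> n (Suc m)"
      using Suc.prems by (rule corner_star[OF \<delta>])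
    have x: "x \<in> corner \<delta> m n"
      using corner_star[OF \<delta> corner_Suc[OF \<delta> sx]] by (simp add: star_star)
    have "\<Psi> (mat_unit (Suc m) n x) = star (\<Psi> (mat_unit n (Suc m) (star x)))"
      using adj[OF sx] by (simp add: star_star)
    also have "\<dots> = star U * star (\<Psi> (mat_unit n m (star x)))"
      by (simp add: step[OF sx] star_mult)
    also have "\<dots> = star U * \<Psi> (mat_unit m n x)"
      by (simp add: adj[OF x] star_star)
    finally show ?case
      using Suc.IH[OF x] by (simp add: mult.assoc)
  qed
qed

lemma matrix_representation_eq_matrix_sum:
  assumes \<Psi>: "matrix_representation \<delta> \<pi> U \<Psi>" and "a \<in> matrix_algebra \<delta>"
  shows "\<Psi> a = matrix_sum \<pi> U a"
  using assms(2)
proof (induction rule: matrix_algebra_induct[OF \<delta>, consumes 1, case_names zero add])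
  case zero
  have "\<Psi> (mat_scale 0 mat_zero) = 0 *\<^sub>C \<Psi> mat_zero"
    using \<Psi> mat_zero_in[OF \<delta>] by (simp only: matrix_representation_def matrix_star_hom_def)
  then show ?case
    by (simp add: mat_scale_zero matrix_sum_zero)
next
  case (add m n x b)
  have "\<Psi> (mat_add (mat_unit m n x) b) = \<Psi> (mat_unit m n x) + \<Psi> b"
    using \<Psi> add mat_unit_in[OF \<delta>] by (simp add: matrix_representation_def matrix_star_hom_def)
  with add show ?case
    by (simp add: matrix_representation_mat_unit[OF \<Psi>] matrix_sum_add mat_unit_in[OF \<delta>]
        matrix_sum_mat_unit)
qed

end

theorem proposition2p2:
  fixes \<delta> :: "'a::unital_cstar_algebra \<Rightarrow> 'a"
    and \<pi> :: "'a \<Rightarrow> 'h::chilbert_space bounded_op"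
    and U :: "'h bounded_op"
  assumes "star_hom \<delta>"
    and "covariant_representation \<delta> \<pi> U"
  shows "(\<exists>!\<Psi>. \<Psi> \<in> extensional (matrix_algebra \<delta>) \<and> matrix_representation \<delta> \<pi> U \<Psi>) \<and>
    (\<forall>\<Psi>. matrix_representation \<delta> \<pi> U \<Psi> \<longrightarrow>
        (\<forall>a\<in>matrix_algebra \<delta>. \<Psi> a = matrix_sum \<pi> U a)) \<and>
    C0_star \<pi> U = {matrix_sum \<pi> U a | a. a \<in> matrix_algebra \<delta>}"
proof (intro conjI)
  let ?M = "matrix_algebra \<delta>"
  show "\<exists>!\<Psi>. \<Psi> \<in> extensional ?M \<and> matrix_representation \<delta> \<pi> U \<Psi>"
  proof (rule ex1I[of _ "restrict (matrix_sum \<pi> U) ?M"])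
    have "matrix_representation \<delta> \<pi> U (restrict (matrix_sum \<pi> U) ?M)
        \<longleftrightarrow> matrix_representation \<delta> \<pi> U (matrix_sum \<pi> U)"
      by (rule matrix_representation_cong[OF assms]) simp
    then show "restrict (matrix_sum \<pi> U) ?M \<in> extensional ?M
        \<and> matrix_representation \<delta> \<pi> U (restrict (matrix_sum \<pi> U) ?M)"
      using matrix_representation_matrix_sum[OF assms] by simp
  next
    fix \<Psi>
    assume "\<Psi> \<in> extensional ?M \<and> matrix_representation \<delta> \<pi> U \<Psi>"
    then show "\<Psi> = restrict (matrix_sum \<pi> U) ?M"
      by (intro extensionalityI[of _ ?M])
        (auto simp: matrix_representation_eq_matrix_sum[OF assms])
  qed
  show "\<forall>\<Psi>. matrix_representation \<delta> \<pi> U \<Psi> \<longrightarrow> (\<forall>a\<in>?M. \<Psi> a = matrix_sum \<pi> U a)"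
    using matrix_representation_eq_matrix_sum[OF assms] by blast
  show "C0_star \<pi> U = {matrix_sum \<pi> U a | a. a \<in> ?M}"
    unfolding range_matrix_sum[OF assms, symmetric] by blast
qed

end
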